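(* Let $G$ be a graph with $n$ vertices, and let $b,a,n',m,\Delta$ be non-negative integers with $b-\Delta\ge a\ge 2$, $\delta(G)\ge\frac{b(b-\Delta)}{\Delta+a}+m+n'$ and $n>\frac{(b+a+2m-2)(a+b)}{\Delta+a}+n'$. Let $g,f$ be integer-valued functions on $V(G)$ with $b-\Delta\ge f(x)-\Delta\ge g(x)\ge a$ for every vertex $x$. If $\sigma_2(G)\ge\frac{2(n(b-\Delta)+n'(\Delta+a))}{b+a}$, then $G$ is fractional $(g,f,n',m)$-critical deleted.
   Context: All graphs are finite and simple; $\delta(G)$ is the minimum degree and $\sigma_2(G)=\min\{d_G(u)+d_G(v): u\ne v,\ uv\notin E(G)\}$. For integer-valued functions $g\le f$ on $V(G)$, a fractional $(g,f)$-factor of $G$ is a function $h:E(G)\to[0,1]$ such that $g(x)\le\sum_{e\ni x}h(e)\le f(x)$ for every vertex $x$. $G$ is fractional $(g,f,m)$-deleted if for every $H\subseteq E(G)$ with $|H|=m$, $G-H$ has a fractional $(g,f)$-factor. $G$ is fractional $(g,f,n',m)$-critical deleted if for every $U\subseteq V(G)$ with $|U|=n'$, $G-U$ is fractional $(g,f,m)$-deleted (with $g,f$ restricted to $V(G)\setminus U$). *)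

theory Defs
  imports Complex_Main "HOL-Library.Extended_Real"
begin

text \<open>A finite simple graph is given by its vertex set \<open>V\<close> and its edge set \<open>E\<close>, edges being
  two-element subsets of \<open>V\<close>.\<close>

definition simple_graph :: "'a set \<Rightarrow> 'a set set \<Rightarrow> bool" where
  "simple_graph V E \<longleftrightarrow> finite V \<and> (\<forall>e\<in>E. e \<subseteq> V \<and> card e = 2)"

definition degree :: "'a set set \<Rightarrow> 'a \<Rightarrow> nat" where
  "degree E x = card {e \<in> E. x \<in> e}"

definition min_degree :: "'a set \<Rightarrow> 'a set set \<Rightarrow> nat" where
  "min_degree V E = Min (degree E ` V)"

text \<open>Extended-real valued, so that \<open>\<sigma>\<^sub>2\<close> of a complete graph (minimum over the empty set) is
  \<open>\<infinity>\<close>, the usual convention.\<close>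

definition sigma2 :: "'a set \<Rightarrow> 'a set set \<Rightarrow> ereal" where
  "sigma2 V E = Inf {ereal (real (degree E u + degree E v)) | u v.
     u \<in> V \<and> v \<in> V \<and> u \<noteq> v \<and> {u, v} \<notin> E}"

definition fractional_factor ::
  "'a set \<Rightarrow> 'a set set \<Rightarrow> ('a \<Rightarrow> int) \<Rightarrow> ('a \<Rightarrow> int) \<Rightarrow> ('a set \<Rightarrow> real) \<Rightarrow> bool" where
  "fractional_factor V E g f h \<longleftrightarrow>
     (\<forall>e\<in>E. 0 \<le> h e \<and> h e \<le> 1) \<and>
     (\<forall>x\<in>V. real_of_int (g x) \<le> (\<Sum>e\<in>{e \<in> E. x \<in> e}. h e) \<and>
            (\<Sum>e\<in>{e \<in> E. x \<in> e}. h e) \<le> real_of_int (f x))"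

definition fractional_deleted ::
  "'a set \<Rightarrow> 'a set set \<Rightarrow> ('a \<Rightarrow> int) \<Rightarrow> ('a \<Rightarrow> int) \<Rightarrow> nat \<Rightarrow> bool" where
  "fractional_deleted V E g f m \<longleftrightarrow>
     (\<forall>H. H \<subseteq> E \<and> card H = m \<and> finite H \<longrightarrow> (\<exists>h. fractional_factor V (E - H) g f h))"

text \<open>\<open>G - U\<close> has vertex set \<open>V - U\<close> and keeps the edges disjoint from \<open>U\<close>.  The functions \<open>g\<close>, \<open>f\<close>
  need no explicit restriction, since only their values on \<open>V - U\<close> are then used.\<close>

definition fractional_critical_deleted ::
  "'a set \<Rightarrow> 'a set set \<Rightarrow> ('a \<Rightarrow> int) \<Rightarrow> ('a \<Rightarrow> int) \<Rightarrow> nat \<Rightarrow> nat \<Rightarrow> bool" where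
  "fractional_critical_deleted V E g f n' m \<longleftrightarrow>
     (\<forall>U. U \<subseteq> V \<and> card U = n' \<and> finite U \<longrightarrow>
        fractional_deleted (V - U) {e \<in> E. e \<inter> U = {}} g f m)"

end

theory Submission imports Defs begin

text \<open>
  By an alternating-path argument on the oriented edges (darts), a fractional \<open>(g, f)\<close>-factor of a
  graph exists as soon as \<open>f(S) - g(T) + d\<^bsub>G-S\<^esub>(T) \<ge> 0\<close> for all disjoint \<open>S\<close>, \<open>T\<close>.

  Put \<open>p = \<Delta> + a\<close>, \<open>q = b - \<Delta>\<close>, \<open>N = n - n'\<close>. A violating pair for \<open>G - U - H\<close> satisfies
  \<open>p|S| + d(T) + 1 \<le> q|T|\<close>. If \<open>|T| \<le> b\<close>, the minimum degree bounds \<open>|S|\<close> from below, a contradiction.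
  Otherwise let \<open>e\<close> be the degree in \<open>G - U - S\<close> before deleting \<open>H\<close>, so that \<open>d(T) \<ge> e(T) - 2m\<close>;
  let \<open>x\<^sub>1\<close> minimise \<open>e\<close> on \<open>T\<close>, and let \<open>x\<^sub>2\<close> minimise \<open>e\<close> among the vertices of \<open>T\<close> not adjacent to
  \<open>x\<^sub>1\<close>. If \<open>e(x\<^sub>1) \<ge> q\<close> or \<open>e(x\<^sub>2) \<ge> q\<close>, the minimum degree again gives a contradiction. If not, the
  condition on \<open>\<sigma>\<^sub>2\<close> yields \<open>2|S| \<ge> 2Nq/(p + q) - e(x\<^sub>1) - e(x\<^sub>2)\<close>, and with \<open>|T| \<le> N - |S|\<close> and the
  lower bound on \<open>n\<close> everything reduces to a quadratic inequality in \<open>e(x\<^sub>1)\<close> and \<open>e(x\<^sub>2)\<close>.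
\<close>

section \<open>Degree-constrained subrelations\<close>

definition out_deg :: "('a \<times> 'a) set \<Rightarrow> 'a \<Rightarrow> nat" where
  "out_deg F x = card (F `` {x})"

abbreviation in_deg :: "('a \<times> 'a) set \<Rightarrow> 'a \<Rightarrow> nat" where
  "in_deg F \<equiv> out_deg (F\<inverse>)"

definition subrel_bounded ::
  "'a set \<Rightarrow> ('a \<times> 'a) set \<Rightarrow> ('a \<Rightarrow> nat) \<Rightarrow> ('a \<times> 'a) set \<Rightarrow> bool" where
  "subrel_bounded V D f F \<longleftrightarrow> F \<subseteq> D \<and> (\<forall>x\<in>V. out_deg F x \<le> f x \<and> in_deg F x \<le> f x)"

text \<open>The potential to be maximised. Because of the truncation at \<open>g\<close> it measures
  progress towards the lower bounds only; for finite \<open>V\<close> it reaches twice the sum of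
  \<open>g\<close> exactly when all of them hold.\<close>

definition saturation :: "'a set \<Rightarrow> ('a \<Rightarrow> nat) \<Rightarrow> ('a \<times> 'a) set \<Rightarrow> nat" where
  "saturation V g F = (\<Sum>x\<in>V. min (g x) (out_deg F x)) + (\<Sum>x\<in>V. min (g x) (in_deg F x))"

text \<open>Inserting \<open>(u, y)\<close> and removing \<open>(v, y)\<close> moves one unit of
  out-degree from \<open>v\<close> to \<open>u\<close> and keeps every in-degree.\<close>

definition alt_step :: "('a \<times> 'a) set \<Rightarrow> ('a \<times> 'a) set \<Rightarrow> 'a \<Rightarrow> 'a \<Rightarrow> bool" where
  "alt_step D F u v \<longleftrightarrow> (\<exists>y. (u, y) \<in> D - F \<and> (v, y) \<in> F)"

section \<open>Degree changes and augmentation along alternating chains\<close>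

lemma out_deg_insert:
  assumes "finite F" "(x, y) \<notin> F"
  shows "out_deg (insert (x, y) F) u = out_deg F u + (if u = x then 1 else 0)"
proof -
  have "insert (x, y) F `` {u} = (if u = x then insert y (F `` {u}) else F `` {u})" by auto
  moreover have "finite (F `` {u})" using assms(1) by (rule finite_Image)
  ultimately show ?thesis using assms(2) by (auto simp: out_deg_def)
qed

lemma in_deg_insert:
  assumes "finite F" "(x, y) \<notin> F"
  shows "in_deg (insert (x, y) F) u = in_deg F u + (if u = y then 1 else 0)"
proof -
  have "(insert (x, y) F)\<inverse> = insert (y, x) (F\<inverse>)" by auto
  then show ?thesis using out_deg_insert[of "F\<inverse>" y x u] assms by simp
qed

lemma out_deg_exchange:
  assumes "finite F" "(x, y) \<notin> F" "(z, y) \<in> F"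
  shows "out_deg (insert (x, y) (F - {(z, y)})) u + (if u = z then 1 else 0)
           = out_deg F u + (if u = x then 1 else 0)"
    and "in_deg (insert (x, y) (F - {(z, y)})) u = in_deg F u"
proof -
  have F: "insert (z, y) (F - {(z, y)}) = F" using assms(3) by blast
  show "out_deg (insert (x, y) (F - {(z, y)})) u + (if u = z then 1 else 0)
           = out_deg F u + (if u = x then 1 else 0)"
    using out_deg_insert[of "F - {(z, y)}" z y u] out_deg_insert[of "F - {(z, y)}" x y u] assms F
    by auto
  show "in_deg (insert (x, y) (F - {(z, y)})) u = in_deg F u"
    using in_deg_insert[of "F - {(z, y)}" z y u] in_deg_insert[of "F - {(z, y)}" x y u] assms F
    by auto
qed

text \<open>Exchanging along the first step moves the deficit from \<open>x\<close> to the next vertex; as the chain has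
  no repetitions, the rest of it stays alternating.\<close>

lemma augment_along_chain:
  assumes V: "finite V" and D: "D \<subseteq> V \<times> V" and gf: "\<forall>x\<in>V. g x \<le> f x"
    and F: "subrel_bounded V D f F"
    and chain: "successively (alt_step D F) (x # xs)" "distinct (x # xs)"
    and x: "x \<in> V" "out_deg F x < g x"
    and last: "(\<exists>y. (last (x # xs), y) \<in> D - F \<and> in_deg F y < f y)
      \<or> g (last (x # xs)) < out_deg F (last (x # xs))"
  shows "\<exists>F'. subrel_bounded V D f F' \<and> saturation V g F < saturation V g F'"
  using F chain x last
proof (induction xs arbitrary: F x)
  case Nil
  then obtain y where y: "(x, y) \<in> D" "(x, y) \<notin> F" "in_deg F y < f y" by auto
  have fin: "finite F" using Nil.prems(1) V D
    by (metis finite_SigmaI finite_subset subrel_bounded_def)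
  note o = out_deg_insert[OF fin y(2)] and i = in_deg_insert[OF fin y(2)]
  let ?F = "insert (x, y) F"
  have "subrel_bounded V D f ?F"
    unfolding subrel_bounded_def
  proof (intro conjI ballI)
    show "?F \<subseteq> D" using Nil.prems(1) y(1) by (auto simp: subrel_bounded_def)
    fix u assume u: "u \<in> V"
    then show "out_deg ?F u \<le> f u" "in_deg ?F u \<le> f u"
      using Nil.prems(1,5) gf y(3) by (fastforce simp: subrel_bounded_def o i)+
  qed
  moreover have "saturation V g F < saturation V g ?F"
    unfolding saturation_def
  proof (rule add_less_le_mono)
    show "(\<Sum>x\<in>V. min (g x) (out_deg F x)) < (\<Sum>x\<in>V. min (g x) (out_deg ?F x))"
      using Nil.prems(4,5) V by (intro sum_strict_mono_ex1) (auto simp: o intro!: bexI[of _ x])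
    show "(\<Sum>x\<in>V. min (g x) (in_deg F x)) \<le> (\<Sum>x\<in>V. min (g x) (in_deg ?F x))"
      by (intro sum_mono) (auto simp: i)
  qed
  ultimately show ?case by blast
next
  case (Cons z zs)
  then obtain y where y: "(x, y) \<in> D" "(x, y) \<notin> F" "(z, y) \<in> F"
    by (auto simp: alt_step_def)
  have fin: "finite F" using Cons.prems(1) V D
    by (metis finite_SigmaI finite_subset subrel_bounded_def)
  have xz: "x \<noteq> z" using Cons.prems(3) by auto
  have zV: "z \<in> V" using y(3) Cons.prems(1) D by (auto simp: subrel_bounded_def)
  define F2 where "F2 = insert (x, y) (F - {(z, y)})"
  note o = out_deg_exchange(1)[OF fin y(2,3), folded F2_def]
    and i = out_deg_exchange(2)[OF fin y(2,3), folded F2_def]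
  have ox: "out_deg F2 x = out_deg F x + 1" using o[of x] xz by simp
  have oz: "out_deg F2 z + 1 = out_deg F z" using o[of z] xz by simp
  have ou: "out_deg F2 u = out_deg F u" if "u \<noteq> x" "u \<noteq> z" for u using o[of u] that by simp
  have bd: "subrel_bounded V D f F2"
    unfolding subrel_bounded_def
  proof (intro conjI ballI)
    show "F2 \<subseteq> D" using Cons.prems(1) y(1) by (auto simp: subrel_bounded_def F2_def)
    fix u assume u: "u \<in> V"
    show "in_deg F2 u \<le> f u" using Cons.prems(1) u by (simp add: i subrel_bounded_def)
    show "out_deg F2 u \<le> f u"
    proof (cases "u = x")
      case True
      then show ?thesis using ox Cons.prems(5) gf u by fastforce
    next
      case False
      then have "out_deg F2 u \<le> out_deg F u" using o[of u] by simp
      also have "\<dots> \<le> f u" using Cons.prems(1) u by (simp add: subrel_bounded_def)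
      finally show ?thesis .
    qed
  qed
  show ?case
  \<comment> \<open>If \<open>z\<close> has a surplus over \<open>g\<close>, this single exchange
    already gains at \<open>x\<close> and costs nothing at \<open>z\<close>.\<close>
  proof (cases "g z < out_deg F z")
    case True
    have "saturation V g F < saturation V g F2"
      unfolding saturation_def i
    proof (intro add_strict_right_mono sum_strict_mono_ex1 V ballI bexI)
      fix u assume "u \<in> V"
      show "min (g u) (out_deg F u) \<le> min (g u) (out_deg F2 u)"
        using ox oz ou[of u] True by (cases "u = x"; cases "u = z") auto
    next
      show "min (g x) (out_deg F x) < min (g x) (out_deg F2 x)"
        using ox Cons.prems(5) by simp
    qed (rule Cons.prems(4))
    then show ?thesis using bd by blast
  next
    case False
    \<comment> \<open>The inserted dart starts at \<open>x\<close> and the removed one at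
      \<open>z\<close>, so only steps leaving \<open>x\<close> or entering \<open>z\<close> can be
      spoiled; distinctness excludes both from the remaining chain.\<close>
    have step: "alt_step D F2 u v"
      if "alt_step D F u v" "u \<in> set (z # zs)" "v \<in> set zs" for u v
    proof -
      obtain y' where y': "(u, y') \<in> D" "(u, y') \<notin> F" "(v, y') \<in> F"
        using \<open>alt_step D F u v\<close> by (auto simp: alt_step_def)
      moreover have "u \<noteq> x" "v \<noteq> z" using that Cons.prems(3) by auto
      ultimately show ?thesis by (auto simp: alt_step_def F2_def)
    qed
    have ch: "successively (alt_step D F2) (z # zs)"
    proof -
      have "\<forall>i. Suc i < length (z # zs) \<longrightarrow> alt_step D F2 ((z # zs) ! i) ((z # zs) ! Suc i)"
      proof (intro allI impI)
        fix i assume i: "Suc i < length (z # zs)"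
        have "successively (alt_step D F) (z # zs)" using Cons.prems(2) by simp
        then have "alt_step D F ((z # zs) ! i) ((z # zs) ! Suc i)"
          using i successively_nth by blast
        moreover have "(z # zs) ! i \<in> set (z # zs)" using i by (meson Suc_lessD nth_mem)
        moreover have "(z # zs) ! Suc i \<in> set zs" using i by simp
        ultimately show "alt_step D F2 ((z # zs) ! i) ((z # zs) ! Suc i)" by (rule step)
      qed
      then show ?thesis by (simp add: successively_conv_nth)
    qed
    have lx: "last (z # zs) \<noteq> x" using Cons.prems(3) last_in_set[of "z # zs"] by force
    have la: "(\<exists>y. (last (z # zs), y) \<in> D - F2 \<and> in_deg F2 y < f y)
      \<or> g (last (z # zs)) < out_deg F2 (last (z # zs))"
      using Cons.prems(6)
    proof
      assume "\<exists>y. (last (x # z # zs), y) \<in> D - F \<and> in_deg F y < f y"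
      then obtain y' where "(last (z # zs), y') \<in> D - F" "in_deg F y' < f y'" by auto
      then have "(last (z # zs), y') \<in> D - F2" "in_deg F2 y' < f y'"
        using lx by (simp_all only: i) (auto simp: F2_def)
      then show ?thesis by blast
    next
      assume *: "g (last (x # z # zs)) < out_deg F (last (x # z # zs))"
      with False have "last (z # zs) \<noteq> z" by auto
      with * lx ou show ?thesis by simp
    qed
    \<comment> \<open>Both \<open>x\<close> before the exchange and \<open>z\<close> after it lie
      strictly below \<open>g\<close>, so the truncated sum loses at \<open>z\<close> exactly what
      it gains at \<open>x\<close>.\<close>
    have sat: "saturation V g F2 = saturation V g F"
    proof -
      have "min (g u) (out_deg F2 u) + (if u = z then 1 else 0)
          = min (g u) (out_deg F u) + (if u = x then 1 else 0)" for u
        using ox oz ou[of u] False Cons.prems(5) xz by auto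
      then have "(\<Sum>u\<in>V. min (g u) (out_deg F2 u) + (if u = z then 1 else 0))
          = (\<Sum>u\<in>V. min (g u) (out_deg F u) + (if u = x then 1 else 0))" by simp
      then have "(\<Sum>u\<in>V. min (g u) (out_deg F2 u)) = (\<Sum>u\<in>V. min (g u) (out_deg F u))"
        using V zV Cons.prems(4) by (simp add: sum.distrib)
      then show ?thesis by (simp add: saturation_def i)
    qed
    have "distinct (z # zs)" using Cons.prems(3) by simp
    moreover have "out_deg F2 z < g z" using oz False by simp
    ultimately show ?thesis using Cons.IH[OF bd ch _ zV _ la] sat by simp
  qed
qed

text \<open>Loops are cut: if \<open>x\<close> recurs in the chain built so far, the suffix starting
  at \<open>x\<close> is kept.\<close>

lemma rtranclp_distinct_chain:
  assumes "R\<^sup>*\<^sup>* x z"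
  obtains xs where "successively R (x # xs)" "distinct (x # xs)" "last (x # xs) = z"
proof -
  have "\<exists>xs. successively R (x # xs) \<and> distinct (x # xs) \<and> last (x # xs) = z"
    using assms
  proof (induction rule: converse_rtranclp_induct)
    case base
    show ?case by (rule exI[of _ "[]"]) simp
  next
    case (step x y)
    then obtain ys where ys: "successively R (y # ys)" "distinct (y # ys)" "last (y # ys) = z"
      by blast
    show ?case
    proof (cases "x \<in> set (y # ys)")
      case True
      then obtain us vs where uv: "y # ys = us @ x # vs" by (meson split_list)
      then have "successively R (x # vs)" "distinct (x # vs)" "last (x # vs) = z"
        using ys by (auto simp: successively_append_iff)
      then show ?thesis by blast
    next
      case False
      then show ?thesis using ys step.hyps(1) by (intro exI[of _ "y # ys"]) auto
    qed
  qed
  then show ?thesis using that by blast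
qed

section \<open>A Hall-type condition suffices\<close>

lemma sum_out_deg:
  assumes "finite F" "finite T"
  shows "(\<Sum>x\<in>T. out_deg F x) = card (F \<inter> T \<times> UNIV)"
proof -
  have "F \<inter> T \<times> UNIV = Sigma T (\<lambda>x. F `` {x})" by auto
  then show ?thesis using assms by (simp add: out_deg_def finite_Image)
qed

lemma sum_in_deg:
  assumes "finite F" "finite S"
  shows "(\<Sum>x\<in>S. in_deg F x) = card (F \<inter> UNIV \<times> S)"
proof -
  have "(F \<inter> UNIV \<times> S)\<inverse> = F\<inverse> \<inter> S \<times> UNIV" by auto
  then show ?thesis using sum_out_deg[of "F\<inverse>" S] assms by (metis card_inverse finite_converse)
qed

lemma max_saturation_out_deg:
  assumes V: "finite V" and D: "D \<subseteq> V \<times> V" and gf: "\<forall>x\<in>V. g x \<le> f x"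
    and F: "subrel_bounded V D f F"
    and max: "\<And>F'. subrel_bounded V D f F' \<Longrightarrow> saturation V g F' \<le> saturation V g F"
    and hall: "\<And>S T. S \<subseteq> V \<Longrightarrow> T \<subseteq> V \<Longrightarrow>
      (\<Sum>x\<in>T. g x) \<le> (\<Sum>x\<in>S. f x) + card (D \<inter> T \<times> (V - S))"
    and x: "x \<in> V"
  shows "g x \<le> out_deg F x"
proof (rule ccontr)
  assume "\<not> g x \<le> out_deg F x"
  then have xdef: "out_deg F x < g x" by simp
  have FD: "F \<subseteq> D" using F by (simp add: subrel_bounded_def)
  have fin: "finite F" using FD V D by (metis finite_SigmaI finite_subset)
  define T where "T = {z. (alt_step D F)\<^sup>*\<^sup>* x z}"
  define S where "S = {y. \<exists>z\<in>T. (z, y) \<in> D - F}"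
  have TV: "T \<subseteq> V"
  proof
    fix z assume "z \<in> T"
    then have "(alt_step D F)\<^sup>*\<^sup>* x z" by (simp add: T_def)
    then show "z \<in> V" using x FD D by (induction rule: rtranclp_induct) (auto simp: alt_step_def)
  qed
  have SV: "S \<subseteq> V" using D by (auto simp: S_def)
  have fS: "finite S" and fT: "finite T" using SV TV V finite_subset by auto
  have noaug: "\<not> ((\<exists>y. (z, y) \<in> D - F \<and> in_deg F y < f y) \<or> g z < out_deg F z)" if "z \<in> T" for z
  proof
    assume *: "(\<exists>y. (z, y) \<in> D - F \<and> in_deg F y < f y) \<or> g z < out_deg F z"
    obtain xs where xs: "successively (alt_step D F) (x # xs)" "distinct (x # xs)"
      "last (x # xs) = z"
      using rtranclp_distinct_chain \<open>z \<in> T\<close> unfolding T_def by (metis mem_Collect_eq)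
    show False
      using augment_along_chain[OF V D gf F xs(1,2) x xdef] * xs(3) max by (metis linorder_not_le)
  qed
  have inS: "in_deg F y = f y" if yS: "y \<in> S" for y
  proof (rule antisym)
    show "in_deg F y \<le> f y" using F SV yS by (auto simp: subrel_bounded_def)
    obtain z where z: "z \<in> T" "(z, y) \<in> D - F" using yS unfolding S_def by blast
    show "f y \<le> in_deg F y"
    proof (rule leI)
      show "\<not> in_deg F y < f y" using noaug[OF z(1)] z(2) by blast
    qed
  qed
  have outT: "out_deg F z \<le> g z" if "z \<in> T" for z using noaug[OF that] by auto
  have "x \<in> T" by (simp add: T_def)
  have cl: "v \<in> T" if vy: "(v, y) \<in> F" "y \<in> S" for v y
  proof -
    obtain z where z: "z \<in> T" "(z, y) \<in> D - F" using vy unfolding S_def by blast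
    then have "alt_step D F z v" using vy by (auto simp: alt_step_def)
    with z(1) show ?thesis unfolding T_def by auto
  qed
  have "(\<Sum>z\<in>T. out_deg F z) = card (F \<inter> T \<times> UNIV)" using fin fT by (rule sum_out_deg)
  \<comment> \<open>By the choice of \<open>S\<close>, every dart of \<open>D\<close> from
    \<open>T\<close> that misses \<open>S\<close> is in \<open>F\<close>; by \<open>cl\<close>,
    every dart of \<open>F\<close> into \<open>S\<close> starts in \<open>T\<close>.\<close>
  also have "F \<inter> T \<times> UNIV = (F \<inter> UNIV \<times> S) \<union> (D \<inter> T \<times> (V - S))"
    using cl FD D by (auto simp: S_def)
  also have "card \<dots> = card (F \<inter> UNIV \<times> S) + card (D \<inter> T \<times> (V - S))"
    using fin fT V by (intro card_Un_disjoint) auto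
  also have "card (F \<inter> UNIV \<times> S) = (\<Sum>y\<in>S. f y)"
    using sum_in_deg[OF fin fS] inS by simp
  finally have "(\<Sum>z\<in>T. out_deg F z) = (\<Sum>y\<in>S. f y) + card (D \<inter> T \<times> (V - S))" .
  moreover have "(\<Sum>z\<in>T. out_deg F z) < (\<Sum>z\<in>T. g z)"
    using outT xdef \<open>x \<in> T\<close> fT by (intro sum_strict_mono_ex1) auto
  ultimately show False using hall[OF SV TV] by simp
qed

text \<open>As \<open>D\<close> is symmetric, reversing a maximiser of the saturation gives another
  one, so the bound on out-degrees also yields the one on in-degrees.\<close>

lemma degree_constrained_subrelation:
  assumes V: "finite V" and D: "D \<subseteq> V \<times> V" "sym D" and gf: "\<forall>x\<in>V. g x \<le> f x"
    and hall: "\<And>S T. S \<subseteq> V \<Longrightarrow> T \<subseteq> V \<Longrightarrow>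
      (\<Sum>x\<in>T. g x) \<le> (\<Sum>x\<in>S. f x) + card (D \<inter> T \<times> (V - S))"
  obtains F where "F \<subseteq> D"
    "\<And>x. x \<in> V \<Longrightarrow> g x \<le> out_deg F x \<and> out_deg F x \<le> f x \<and> g x \<le> in_deg F x \<and> in_deg F x \<le> f x"
proof -
  have DD: "D\<inverse> = D" using D(2) by (simp add: sym_conv_converse_eq)
  have "finite {F. subrel_bounded V D f F}"
    by (rule finite_subset[of _ "Pow D"])
      (use V D(1) in \<open>auto simp: subrel_bounded_def intro: finite_subset\<close>)
  moreover have "subrel_bounded V D f {}" by (simp add: subrel_bounded_def out_deg_def)
  ultimately obtain F where F: "subrel_bounded V D f F"
    and max: "\<And>F'. subrel_bounded V D f F' \<Longrightarrow> saturation V g F' \<le> saturation V g F"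
    using Max_in[of "saturation V g ` {F. subrel_bounded V D f F}"]
      Max_ge[of "saturation V g ` {F. subrel_bounded V D f F}"]
    by (smt (verit) empty_iff finite_imageI image_iff mem_Collect_eq)
  have conv: "subrel_bounded V D f (F'\<inverse>)" "saturation V g (F'\<inverse>) = saturation V g F'"
    if "subrel_bounded V D f F'" for F'
    using that DD by (auto simp: subrel_bounded_def saturation_def)
  show ?thesis
  proof (rule that[of F])
    show "F \<subseteq> D" using F by (simp add: subrel_bounded_def)
    fix x assume x: "x \<in> V"
    have "g x \<le> out_deg F x" by (rule max_saturation_out_deg[OF V D(1) gf F max hall x])
    moreover have "g x \<le> in_deg F x"
      by (rule max_saturation_out_deg[OF V D(1) gf _ _ hall x]) (use conv F max in auto)
    ultimately show "g x \<le> out_deg F x \<and> out_deg F x \<le> f x \<and> g x \<le> in_deg F x \<and> in_deg F x \<le> f x"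
      using F x by (simp add: subrel_bounded_def)
  qed
qed

section \<open>A sufficient condition for fractional factors\<close>

definition darts :: "'a set set \<Rightarrow> ('a \<times> 'a) set" where
  "darts E = {(x, y). {x, y} \<in> E}"

lemma edge_cases:
  assumes "simple_graph V E" "e \<in> E" "x \<in> e"
  obtains y where "e = {x, y}" "x \<noteq> y" "x \<in> V" "y \<in> V"
proof -
  have e: "e \<subseteq> V" "card e = 2" using assms(1,2) by (auto simp: simple_graph_def)
  then obtain u v where "e = {u, v}" "u \<noteq> v" by (auto simp: card_2_iff)
  then show ?thesis using that e(1) assms(3) by auto
qed

lemma no_loops: "simple_graph V E \<Longrightarrow> {x, y} \<in> E \<Longrightarrow> x \<noteq> y"
  by (force simp: simple_graph_def)

lemma simple_graph_finite: "simple_graph V E \<Longrightarrow> finite E"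
  by (rule finite_subset[of _ "Pow V"]) (auto simp: simple_graph_def)

lemma incident_edges_bij:
  assumes "simple_graph V E"
  shows "bij_betw (\<lambda>y. {x, y}) {y. {x, y} \<in> E} {e \<in> E. x \<in> e}"
  unfolding bij_betw_def
proof
  show "inj_on (\<lambda>y. {x, y}) {y. {x, y} \<in> E}" by (auto simp: inj_on_def doubleton_eq_iff)
  show "(\<lambda>y. {x, y}) ` {y. {x, y} \<in> E} = {e \<in> E. x \<in> e}"
    using edge_cases[OF assms] by blast
qed

lemma degree_eq_card_neighbours:
  "simple_graph V E \<Longrightarrow> degree E x = card {y. {x, y} \<in> E}"
  unfolding degree_def using bij_betw_same_card[OF incident_edges_bij] by metis

text \<open>Averaging a dart set over the two orientations of each edge gives a half-integral weighting.\<close>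

lemma sum_dart_average:
  assumes G: "simple_graph V E" and F: "F \<subseteq> darts E"
  shows "(\<Sum>e\<in>{e \<in> E. x \<in> e}. real (card {p \<in> F. {fst p, snd p} = e}) / 2)
           = (real (out_deg F x) + real (in_deg F x)) / 2"
proof -
  let ?N = "{y. {x, y} \<in> E}"
  have fN: "finite ?N"
    by (rule finite_subset[of _ V]) (use G in \<open>auto simp: simple_graph_def\<close>)
  have *: "real (card {p \<in> F. {fst p, snd p} = {x, y}})
      = of_bool ((x, y) \<in> F) + of_bool ((y, x) \<in> F)" if "y \<in> ?N" for y
  proof -
    have "x \<noteq> y" using no_loops[OF G] that by blast
    have "{p \<in> F. {fst p, snd p} = {x, y}} = F \<inter> {(x, y), (y, x)}"
      by (auto simp: doubleton_eq_iff)
    then show ?thesis using \<open>x \<noteq> y\<close> by (auto simp: Int_insert_right)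
  qed
  have "(\<Sum>e\<in>{e \<in> E. x \<in> e}. real (card {p \<in> F. {fst p, snd p} = e}) / 2)
      = (\<Sum>y\<in>?N. real (card {p \<in> F. {fst p, snd p} = {x, y}}) / 2)"
    using sum.reindex_bij_betw[OF incident_edges_bij[OF G, of x],
        where g = "\<lambda>e. real (card {p \<in> F. {fst p, snd p} = e}) / 2"] by simp
  also have "\<dots> = (\<Sum>y\<in>?N. (of_bool ((x, y) \<in> F) + of_bool ((y, x) \<in> F)) / 2)"
    by (intro sum.cong refl) (simp add: *)
  also have "\<dots> = (real (card {y \<in> ?N. (x, y) \<in> F}) + real (card {y \<in> ?N. (y, x) \<in> F})) / 2"
    using fN by (simp add: sum.distrib sum_divide_distrib[symmetric] of_bool_def
        sum.If_cases Int_def)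
  also have "{y \<in> ?N. (x, y) \<in> F} = F `` {x}" using F by (auto simp: darts_def)
  also have "{y \<in> ?N. (y, x) \<in> F} = F\<inverse> `` {x}" using F by (auto simp: darts_def insert_commute)
  finally show ?thesis by (simp add: out_deg_def)
qed

lemma dart_average_le_1:
  assumes "simple_graph V E" "e \<in> E"
  shows "real (card {p \<in> F. {fst p, snd p} = e}) / 2 \<le> 1"
proof -
  obtain x y where e: "e = {x, y}" using assms by (auto simp: simple_graph_def card_2_iff)
  have "card {p \<in> F. {fst p, snd p} = e} \<le> card {(x, y), (y, x)}"
    unfolding e by (intro card_mono) (auto simp: doubleton_eq_iff)
  also have "\<dots> \<le> 2" using card_length[of "[(x, y), (y, x)]"] by simp
  finally show ?thesis by simp
qed

text \<open>A dart set whose out- and in-degrees all lie between \<open>g\<close> and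
  \<open>f\<close> becomes a factor by averaging: the weight at a vertex is the mean of its two
  degrees.\<close>

lemma fractional_factor_exists:
  assumes G: "simple_graph V E" and gf: "\<forall>x\<in>V. 0 \<le> g x \<and> g x \<le> f x"
    and hall: "\<And>S T. S \<subseteq> V \<Longrightarrow> T \<subseteq> V \<Longrightarrow> S \<inter> T = {} \<Longrightarrow>
      (\<Sum>x\<in>T. g x) \<le> (\<Sum>x\<in>S. f x) + (\<Sum>x\<in>T. int (card {y \<in> V - S. {x, y} \<in> E}))"
  shows "\<exists>h. fractional_factor V E g f h"
proof -
  have V: "finite V" using G by (simp add: simple_graph_def)
  let ?D = "darts E"
  have D: "?D \<subseteq> V \<times> V" "sym ?D"
    using G by (auto simp: darts_def simple_graph_def sym_def insert_commute)
  have finD: "finite ?D" using D(1) V by (meson finite_SigmaI finite_subset)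
  have darts_sum: "card (?D \<inter> T \<times> (V - S)) = (\<Sum>x\<in>T. card {y \<in> V - S. {x, y} \<in> E})"
    if "T \<subseteq> V" for S T
  proof -
    have "?D \<inter> T \<times> (V - S) = Sigma T (\<lambda>x. {y \<in> V - S. {x, y} \<in> E})" by (auto simp: darts_def)
    moreover have "finite T" using that V finite_subset by auto
    ultimately show ?thesis using V by simp
  qed
  \<comment> \<open>\<open>S \<inter> T\<close> may be dropped from both sets: each dart gained from \<open>T - S\<close> to \<open>S \<inter> T\<close> is the reverse of
    one lost from \<open>S \<inter> T\<close> to \<open>T - S\<close>.\<close>
  have hall': "(\<Sum>x\<in>T. nat (g x)) \<le> (\<Sum>x\<in>S. nat (f x)) + card (?D \<inter> T \<times> (V - S))"
    if S: "S \<subseteq> V" and T: "T \<subseteq> V" for S T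
  proof -
    have fin: "finite S" "finite T" using S T V finite_subset by auto
    define A where "A = S \<inter> T"
    have fA: "finite A" using fin by (simp add: A_def)
    have AV: "A \<subseteq> V" using S by (auto simp: A_def)
    have hS: "(\<Sum>x\<in>S. int (nat (f x))) = (\<Sum>x\<in>S - T. f x) + (\<Sum>x\<in>A. f x)"
    proof -
      have "S = (S - T) \<union> A" by (auto simp: A_def)
      then have "(\<Sum>x\<in>S. f x) = (\<Sum>x\<in>S - T. f x) + (\<Sum>x\<in>A. f x)"
        using sum.union_disjoint[of "S - T" A f] fin fA by (auto simp: A_def)
      moreover have "(\<Sum>x\<in>S. int (nat (f x))) = (\<Sum>x\<in>S. f x)"
        using gf S by (intro sum.cong refl) force
      ultimately show ?thesis by simp
    qed
    have hT: "(\<Sum>x\<in>T. int (nat (g x))) = (\<Sum>x\<in>T - S. g x) + (\<Sum>x\<in>A. g x)"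
    proof -
      have "T = (T - S) \<union> A" by (auto simp: A_def)
      then have "(\<Sum>x\<in>T. g x) = (\<Sum>x\<in>T - S. g x) + (\<Sum>x\<in>A. g x)"
        using sum.union_disjoint[of "T - S" A g] fin fA by (auto simp: A_def)
      moreover have "(\<Sum>x\<in>T. int (nat (g x))) = (\<Sum>x\<in>T. g x)"
        using gf T by (intro sum.cong refl) force
      ultimately show ?thesis by simp
    qed
    have gfA: "(\<Sum>x\<in>A. g x) \<le> (\<Sum>x\<in>A. f x)" using gf AV by (intro sum_mono) auto
    have h: "(\<Sum>x\<in>T - S. g x) \<le> (\<Sum>x\<in>S - T. f x) + int (card (?D \<inter> (T - S) \<times> (V - (S - T))))"
      using hall[of "S - T" "T - S"] S T darts_sum[of "T - S" "S - T"] by fastforce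
    have "card (?D \<inter> (T - S) \<times> (V - (S - T)))
        \<le> card (?D \<inter> (T - S) \<times> (V - S)) + card (?D \<inter> (T - S) \<times> A)"
    proof (rule order_trans[OF card_mono card_Un_le])
      show "?D \<inter> (T - S) \<times> (V - (S - T)) \<subseteq> ?D \<inter> (T - S) \<times> (V - S) \<union> ?D \<inter> (T - S) \<times> A"
        by (auto simp: A_def)
    qed (use finD in auto)
    also have "card (?D \<inter> (T - S) \<times> A) = card ((?D \<inter> (T - S) \<times> A)\<inverse>)"
      by (simp add: card_inverse)
    also have "(?D \<inter> (T - S) \<times> A)\<inverse> = ?D \<inter> A \<times> (T - S)" using D(2) by (auto simp: sym_def)
    also have "card (?D \<inter> (T - S) \<times> (V - S)) + card (?D \<inter> A \<times> (T - S))
        \<le> card (?D \<inter> T \<times> (V - S))"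
    proof (subst card_Un_disjoint[symmetric])
      show "card (?D \<inter> (T - S) \<times> (V - S) \<union> ?D \<inter> A \<times> (T - S)) \<le> card (?D \<inter> T \<times> (V - S))"
        using T finD by (intro card_mono) (auto simp: A_def)
    qed (use finD in \<open>auto simp: A_def\<close>)
    finally have "int (card (?D \<inter> (T - S) \<times> (V - (S - T)))) \<le> int (card (?D \<inter> T \<times> (V - S)))"
      by simp
    then have "(\<Sum>x\<in>T. int (nat (g x)))
        \<le> (\<Sum>x\<in>S. int (nat (f x))) + int (card (?D \<inter> T \<times> (V - S)))"
      using h hS hT gfA by linarith
    then have "int (\<Sum>x\<in>T. nat (g x)) \<le> int ((\<Sum>x\<in>S. nat (f x)) + card (?D \<inter> T \<times> (V - S)))"
      by (simp only: of_nat_add of_nat_sum)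
    then show ?thesis by (simp only: of_nat_le_iff)
  qed
  have "\<forall>x\<in>V. nat (g x) \<le> nat (f x)" using gf by (auto intro: nat_mono)
  from degree_constrained_subrelation[OF V D this hall'] obtain F where F: "F \<subseteq> ?D"
    "\<And>x. x \<in> V \<Longrightarrow> nat (g x) \<le> out_deg F x \<and> out_deg F x \<le> nat (f x)
      \<and> nat (g x) \<le> in_deg F x \<and> in_deg F x \<le> nat (f x)"
    by blast
  have "fractional_factor V E g f (\<lambda>e. real (card {p \<in> F. {fst p, snd p} = e}) / 2)"
    unfolding fractional_factor_def sum_dart_average[OF G F(1)]
  proof (intro conjI ballI)
    fix e assume "e \<in> E"
    then show "real (card {p \<in> F. {fst p, snd p} = e}) / 2 \<le> 1"
      using dart_average_le_1[OF G] by blast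
  next
    fix x assume x: "x \<in> V"
    have "g x \<le> int (out_deg F x)" "int (out_deg F x) \<le> f x"
      "g x \<le> int (in_deg F x)" "int (in_deg F x) \<le> f x"
      using F(2)[OF x] gf x by (auto simp: nat_le_iff le_nat_iff)
    then have "real_of_int (g x) \<le> real (out_deg F x)" "real (out_deg F x) \<le> real_of_int (f x)"
      "real_of_int (g x) \<le> real (in_deg F x)" "real (in_deg F x) \<le> real_of_int (f x)"
      by linarith+
    then show "real_of_int (g x) \<le> (real (out_deg F x) + real (in_deg F x)) / 2"
      "(real (out_deg F x) + real (in_deg F x)) / 2 \<le> real_of_int (f x)"
      by auto
  qed simp
  then show ?thesis by blast
qed

section \<open>Excluding violating pairs\<close>

lemma obtain_argmin:
  fixes e :: "'a \<Rightarrow> nat"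
  assumes "finite A" "A \<noteq> {}"
  obtains x where "x \<in> A" "\<And>y. y \<in> A \<Longrightarrow> e x \<le> e y"
  using arg_min_if_finite(1)[OF assms, of e] arg_min_least[OF assms, of _ e] by blast

text \<open>Splitting off the square of \<open>k - (e - 1)\<close> leaves
  \<open>k * (P/2 + e/2 - 3)\<close>, nonnegative once \<open>e >= 2\<close>. For
  \<open>e = 1\<close> this remainder may be negative, and integrality saves the bound by leaving
  only \<open>k = 0\<close> and \<open>k = 1\<close>.\<close>

lemma ore_quadratic_nonneg:
  fixes P :: real and e k :: nat
  assumes "P \<ge> 4" "e \<ge> 1" "k \<le> e"
  shows "(real e - 1)^2 + real k * (real k - 1 + P / 2 - 3 * real e / 2) \<ge> 0"
proof (cases "e = 1")
  case True
  then have "k = 0 \<or> k = 1" using assms(3) by auto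
  then show ?thesis using True assms(1) by auto
next
  case False
  then have "P / 2 + real e / 2 - 3 \<ge> 0" using assms(1,2) by linarith
  then have "(real k - (real e - 1))^2 + real k * (P / 2 + real e / 2 - 3) \<ge> 0" by simp
  then show ?thesis by (simp add: power2_eq_square algebra_simps)
qed

text \<open>In the application \<open>d\<close>, \<open>e\<close>, \<open>h\<close> are the degrees of a vertex of \<open>T\<close> outside \<open>S\<close> after the
  deletion of \<open>m\<close> edges, before it, and within the deleted edges.\<close>

lemma small_T_impossible:
  fixes T :: "'a set" and d :: "'a \<Rightarrow> nat" and p q b s :: real
  assumes T: "finite T" "real (card T) \<le> b"
    and p: "0 < p" "p \<le> b" and s: "0 \<le> s"
    and viol: "p * s + (\<Sum>x\<in>T. real (d x)) + 1 \<le> q * real (card T)"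
    and deg: "\<And>x. x \<in> T \<Longrightarrow> b * q / p \<le> s + real (d x)"
  shows False
proof -
  have "0 \<le> p * s" using s p by simp
  then have "T \<noteq> {}" using viol by auto
  then obtain x where x: "x \<in> T" "\<And>y. y \<in> T \<Longrightarrow> d x \<le> d y" using obtain_argmin T(1) by metis
  have "real (card T) * real (d x) \<le> (\<Sum>y\<in>T. real (d y))"
    using sum_mono[of T "\<lambda>_. real (d x)" "\<lambda>y. real (d y)"] x(2) by simp
  then have 1: "p * s + 1 \<le> (q - real (d x)) * real (card T)"
    using viol by (simp add: algebra_simps)
  have "q - real (d x) > 0"
  proof (rule ccontr)
    assume "\<not> ?thesis"
    then have "(q - real (d x)) * real (card T) \<le> 0" by (simp add: mult_nonpos_nonneg)
    moreover have "0 \<le> p * s" using p s by simp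
    ultimately show False using 1 by linarith
  qed
  \<comment> \<open>With \<open>card T <= b\<close> this gives
    \<open>p * s + 1 <= b * q - b * d x\<close>, whereas \<open>deg\<close> and
    \<open>p <= b\<close> give the reverse without the 1.\<close>
  then have "(q - real (d x)) * real (card T) \<le> (q - real (d x)) * b"
    using T(2) by (intro mult_left_mono) auto
  moreover have "b * q \<le> p * s + p * real (d x)"
    using deg[OF x(1)] p(1) by (simp add: field_simps)
  moreover have "p * real (d x) \<le> b * real (d x)" using p(2) by (intro mult_right_mono) auto
  ultimately show False using 1 by (simp add: algebra_simps)
qed

text \<open>All but at most \<open>e x1 + 1\<close> vertices of \<open>T\<close> are distinct from
  and not adjacent to \<open>x1\<close>, hence have degree at least \<open>e x2\<close>. This
  two-level bound on the degree sum is what the violation cannot afford.\<close>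

lemma large_T_impossible:
  fixes T :: "'a set" and d e h :: "'a \<Rightarrow> nat" and p q b s m N :: real
  assumes T: "finite T" "b < real (card T)"
    and pq: "2 \<le> p" "p \<le> b" "2 \<le> q" "q \<le> b" "q \<in> \<int>" and s: "0 \<le> s" and m: "0 \<le> m"
    and viol: "p * s + (\<Sum>x\<in>T. real (d x)) + 1 \<le> q * real (card T)"
    and deh: "\<And>x. x \<in> T \<Longrightarrow> e x \<le> d x + h x"
    and hsum: "(\<Sum>x\<in>T. real (h x)) \<le> 2 * m"
    and deg: "\<And>x. x \<in> T \<Longrightarrow> b * q / p + m \<le> s + real (e x)"
    and nbrs: "\<And>x. x \<in> T \<Longrightarrow> card {y \<in> T. adj x y} \<le> e x"
    and N: "real (card T) + s \<le> N" "(p + q + 2 * m - 2) * (p + q) / p < N"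
    and ore: "\<And>x y. x \<in> T \<Longrightarrow> y \<in> T \<Longrightarrow> x \<noteq> y \<Longrightarrow> \<not> adj x y \<Longrightarrow>
      2 * N * q / (p + q) \<le> 2 * s + real (e x) + real (e y)"
  shows False
proof -
  define t where "t = real (card T)"
  have "T \<noteq> {}" using T pq by auto
  then obtain x1 where x1: "x1 \<in> T" "\<And>y. y \<in> T \<Longrightarrow> e x1 \<le> e y" using obtain_argmin T(1) by metis
  define e1 where "e1 = real (e x1)"
  define W where "W = {y \<in> T. y \<noteq> x1 \<and> \<not> adj x1 y}"
  define w where "w = real (card W)"
  have fW: "finite W" "W \<subseteq> T" using T by (auto simp: W_def)
  have ESUM: "(\<Sum>x\<in>T. real (e x)) \<le> (\<Sum>x\<in>T. real (d x)) + 2 * m"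
  proof -
    have "(\<Sum>x\<in>T. real (e x)) \<le> (\<Sum>x\<in>T. real (d x) + real (h x))"
      by (intro sum_mono) (metis deh of_nat_add of_nat_mono)
    then show ?thesis using hsum by (simp add: sum.distrib)
  qed
  have wt: "t - w \<le> e1 + 1"
  proof -
    have "T = insert x1 (W \<union> {y \<in> T. adj x1 y})" using x1(1) by (auto simp: W_def)
    then have "card T = card (insert x1 (W \<union> {y \<in> T. adj x1 y}))" by simp
    also have "\<dots> \<le> Suc (card (W \<union> {y \<in> T. adj x1 y}))" using fW T by (simp add: card_insert_if)
    also have "\<dots> \<le> Suc (card W + e x1)"
      using card_Un_le nbrs[OF x1(1)] by (meson Suc_le_mono add_left_mono order_trans)
    finally show ?thesis by (simp add: t_def w_def e1_def)
  qed
  have lower: "e1 * t + c * w \<le> (\<Sum>x\<in>T. real (e x))"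
    if c: "\<And>y. y \<in> W \<Longrightarrow> e1 + c \<le> real (e y)" for c
  proof -
    have "e1 * t + c * w = (\<Sum>x\<in>T. e1 + (if x \<in> W then c else 0))"
      using T fW by (simp add: sum.distrib sum.If_cases Int_absorb1 t_def w_def)
    also have "\<dots> \<le> (\<Sum>x\<in>T. real (e x))"
      using x1(2) c by (intro sum_mono) (auto simp: e1_def)
    finally show ?thesis .
  qed
  have viol': "p * s + (\<Sum>x\<in>T. real (e x)) + 1 \<le> q * t + 2 * m"
    using viol ESUM by (simp add: t_def)
  have mindeg: "b * q + p * m \<le> p * s + p * e1"
  proof -
    have "p * (b * q / p + m) \<le> p * (s + e1)"
      using deg[OF x1(1)] pq by (intro mult_left_mono) (auto simp: e1_def)
    then show ?thesis using pq by (simp add: algebra_simps)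
  qed
  \<comment> \<open>The loss \<open>2 * m\<close> from deleting edges is absorbed by the term
    \<open>m\<close> of the minimum degree bound, scaled by \<open>p >= 2\<close>.\<close>
  have pm: "2 * m \<le> p * m" using pq m by (intro mult_right_mono) auto
  \<comment> \<open>Eliminating \<open>s\<close> between \<open>viol'\<close> and
    \<open>mindeg\<close> leaves \<open>(t - b) * e1 + c * w + 1 <= (t - b) * q\<close>. Used with
    \<open>c = 0\<close> to get \<open>e1 < q\<close>, and with \<open>c = e2 - e1\<close> to get
    \<open>e2 < q\<close>.\<close>
  have no_heavy: False if c: "\<And>y. y \<in> W \<Longrightarrow> e1 + c \<le> real (e y)"
      and "(t - b) * q \<le> (t - b) * e1 + c * w" for c
  proof -
    have "p * e1 \<le> b * e1" using pq by (intro mult_right_mono) (auto simp: e1_def)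
    then show False using lower[OF c] viol' mindeg pm that(2) by (simp add: algebra_simps)
  qed
  have tb: "b < t" using T by (simp add: t_def)
  have e1q: "e1 < q"
  proof (rule ccontr)
    assume "\<not> e1 < q"
    then have "(t - b) * q \<le> (t - b) * e1 + 0 * w" using tb by (simp add: mult_left_mono)
    then show False using no_heavy[of 0] fW x1(2) by (fastforce simp: e1_def)
  qed
  \<comment> \<open>Integrality of \<open>q\<close> matters: \<open>e1 + 1 <= q <= b\<close> turns
    \<open>wt\<close> into \<open>t - b <= w\<close>, so \<open>W\<close> is nonempty and
    \<open>x2\<close> exists.\<close>
  have "e1 + 1 \<le> q"
  proof -
    obtain k where "q = of_int k" using pq(5) by (auto elim: Ints_cases)
    moreover from this e1q have "int (e x1) < k"
      by (simp add: e1_def flip: of_int_less_iff[where 'a = real])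
    then have "real_of_int (int (e x1) + 1) \<le> real_of_int k" by (simp only: of_int_le_iff)
    ultimately show ?thesis by (simp add: e1_def)
  qed
  then have wtb: "t - b \<le> w" using wt pq by linarith
  then have "W \<noteq> {}" using tb by (auto simp: w_def)
  then obtain x2 where x2: "x2 \<in> W" "\<And>y. y \<in> W \<Longrightarrow> e x2 \<le> e y" using obtain_argmin fW(1) by metis
  define e2 where "e2 = real (e x2)"
  have e12: "e1 \<le> e2" using x1(2) x2(1) fW by (auto simp: e1_def e2_def)
  have e2W: "e1 + (e2 - e1) \<le> real (e y)" if "y \<in> W" for y
    using x2(2)[OF that] by (simp add: e2_def)
  have e2q: "e2 < q"
  proof (rule ccontr)
    assume "\<not> e2 < q"
    then have "(q - e1) * (t - b) \<le> (e2 - e1) * w" using wtb tb e12 by (intro mult_mono) auto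
    then show False using no_heavy[OF e2W] by (simp add: algebra_simps)
  qed
  define P where "P = p + q"
  \<comment> \<open>In this scale the \<open>sigma2\<close> condition reads
    \<open>s >= M * q - (e1 + e2) / 2\<close>, and the bound on the order reads
    \<open>P + 2 * m - 2 < M * p\<close>.\<close>
  define M where "M = N / P"
  have P4: "P \<ge> 4" using pq by (simp add: P_def)
  have N_eq: "N = M * P" using P4 by (simp add: M_def)
  have ore12: "M * q - (e1 + e2) / 2 \<le> s"
  proof -
    have "2 * N * q / P \<le> 2 * s + e1 + e2"
      using ore[of x1 x2] x1(1) x2(1) by (auto simp: W_def P_def e1_def e2_def)
    moreover have "2 * N * q / P = 2 * (M * q)" by (simp add: M_def)
    ultimately have "2 * (M * q) \<le> 2 * s + e1 + e2" by linarith
    then show ?thesis by (simp add: field_simps)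
  qed
  show False
  \<comment> \<open>The main estimate multiplies the bound on the order by \<open>e2\<close> and
    needs \<open>e2 >= 1\<close> to cover \<open>2 * m\<close>. For \<open>e2 = 0\<close>, the
    original \<open>viol\<close> with \<open>d >= 0\<close> avoids that term altogether.\<close>
  proof (cases "e x2 = 0")
    case True
    then have "e1 = 0" "e2 = 0" using e12 by (auto simp: e1_def e2_def)
    then have "P * (M * q) \<le> P * s" using ore12 P4 by (intro mult_left_mono) auto
    moreover have "0 \<le> (\<Sum>x\<in>T. real (d x))" by (intro sum_nonneg) auto
    then have "p * s + 1 \<le> q * t" using viol by (simp add: t_def)
    moreover have "q * t \<le> q * (N - s)" using N pq by (intro mult_left_mono) (auto simp: t_def)
    ultimately show False by (simp add: N_eq P_def algebra_simps)
  next
    case False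
    then have e2_1: "1 \<le> e2" by (simp add: e2_def)
    have "(e2 - e1) * (t - (e1 + 1)) \<le> (e2 - e1) * w" using wt e12 by (intro mult_left_mono) auto
    then have "p * s + 1 \<le> (q - e2) * t + (e2 - e1) * (e1 + 1) + 2 * m"
      using lower[OF e2W] viol' by (simp add: algebra_simps)
    moreover have "(q - e2) * t \<le> (q - e2) * (N - s)"
      using N e2q by (intro mult_left_mono) (auto simp: t_def)
    ultimately have 1: "(P - e2) * s + 1 \<le> (q - e2) * (M * P) + (e2 - e1) * (e1 + 1) + 2 * m"
      by (simp add: N_eq P_def algebra_simps)
    have 2: "(P - e2) * (M * q - (e1 + e2) / 2) \<le> (P - e2) * s"
      using ore12 e2q pq by (intro mult_left_mono) (auto simp: P_def)
    have "P + 2 * m - 2 < M * p"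
      using N(2) P4 pq by (simp add: M_def P_def[symmetric] field_simps)
    then have "e2 * (P + 2 * m - 2) < e2 * (M * p)" using e2_1 by (intro mult_strict_left_mono) auto
    moreover have "1 * (2 * m) \<le> e2 * (2 * m)" using e2_1 m by (intro mult_right_mono) auto
    ultimately have 3: "e2 * (P - 2) + 2 * m < e2 * (M * p)" by (simp add: algebra_simps)
    have 4: "(P - e2) * (M * q) - (q - e2) * (M * P) = e2 * (M * p)"
      by (simp add: P_def algebra_simps)
    have 5: "(e2 - 1)^2 + (e2 - e1) * ((e2 - e1) - 1 + P / 2 - 3 * e2 / 2) \<ge> 0"
      using ore_quadratic_nonneg[OF P4, of "e x2" "e x2 - e x1"] False e12
      by (simp add: e1_def e2_def of_nat_diff)
    have 6: "(P - e2) * (M * q - (e1 + e2) / 2) = (P - e2) * (M * q) - (P - e2) * (e1 + e2) / 2"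
      by (simp add: algebra_simps)
    \<comment> \<open>After cancelling the \<open>M\<close> terms by 4, what remains says exactly
      that the quadratic in 5, with \<open>k = e2 - e1\<close>, is negative.\<close>
    have 7: "e2 * (P - 2) + 1 < (e2 - e1) * (e1 + 1) + (P - e2) * (e1 + e2) / 2"
      using 1 2 3 4 unfolding 6 by linarith
    show False using 5 7 by (simp add: power2_eq_square field_simps)
  qed
qed

section \<open>From the graph hypotheses to the numerical ones\<close>

lemma sum_degree_le:
  assumes "simple_graph V E" "H \<subseteq> E" "finite T"
  shows "(\<Sum>x\<in>T. degree H x) \<le> 2 * card H"
proof -
  have fH: "finite H" using simple_graph_finite[OF assms(1)] assms(2) finite_subset by auto
  have "(\<Sum>x\<in>T. degree H x) = (\<Sum>x\<in>T. \<Sum>e\<in>H. if x \<in> e then 1 else 0)"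
    using fH by (simp add: degree_def sum.If_cases Int_def)
  \<comment> \<open>Double counting of incidences between \<open>T\<close> and
    \<open>H\<close>.\<close>
  also have "\<dots> = (\<Sum>e\<in>H. card (T \<inter> e))"
    by (subst sum.swap) (use assms(3) in \<open>simp add: sum.If_cases\<close>)
  also have "\<dots> \<le> (\<Sum>e\<in>H. 2)"
  proof (rule sum_mono)
    fix e assume "e \<in> H"
    then have "card e = 2" using assms(1,2) by (auto simp: simple_graph_def)
    moreover from this have "finite e" by (intro card_ge_0_finite) simp
    ultimately show "card (T \<inter> e) \<le> 2" by (metis card_mono inf_le2)
  qed
  finally show ?thesis by simp
qed

lemma degree_le_card: "finite H \<Longrightarrow> degree H x \<le> card H"
  by (auto simp: degree_def intro: card_mono)

theorem theorem3:
  fixes V :: "'a set" and E :: "'a set set"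
    and n b a n' m \<Delta> :: nat
    and g f :: "'a \<Rightarrow> int"
  assumes "simple_graph V E"
    and "card V = n"
    and "int b - int \<Delta> \<ge> int a" and "a \<ge> 2"
    and "real (min_degree V E) \<ge>
           real b * (real b - real \<Delta>) / (real \<Delta> + real a) + real m + real n'"
    and "real n >
           (real b + real a + 2 * real m - 2) * (real a + real b) / (real \<Delta> + real a) + real n'"
    and "\<forall>x\<in>V. int b - int \<Delta> \<ge> f x - int \<Delta> \<and> f x - int \<Delta> \<ge> g x \<and> g x \<ge> int a"
    and "sigma2 V E \<ge>
           ereal (2 * (real n * (real b - real \<Delta>) + real n' * (real \<Delta> + real a))
                    / (real b + real a))"
  shows "fractional_critical_deleted V E g f n' m"
  unfolding fractional_critical_deleted_def fractional_deleted_def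
proof (intro allI impI)
  note G = assms(1)
  have V: "finite V" using G by (simp add: simple_graph_def)
  define p where "p = real \<Delta> + real a"
  define q where "q = real b - real \<Delta>"
  define N where "N = real n - real n'"
  have pq: "2 \<le> p" "p \<le> real b" "2 \<le> q" "q \<le> real b" "q \<in> \<int>"
    using assms(3,4) by (auto simp: p_def q_def)
  fix U H
  assume U: "U \<subseteq> V \<and> card U = n' \<and> finite U"
    and H: "H \<subseteq> {e \<in> E. e \<inter> U = {}} \<and> card H = m \<and> finite H"
  let ?E = "{e \<in> E. e \<inter> U = {}} - H"
  have G': "simple_graph (V - U) ?E" using G by (auto simp: simple_graph_def)
  have GH: "simple_graph V H" using G H by (auto simp: simple_graph_def)
  show "\<exists>h. fractional_factor (V - U) ?E g f h"
  proof (rule fractional_factor_exists[OF G'])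
    show "\<forall>x\<in>V - U. 0 \<le> g x \<and> g x \<le> f x" using assms(7) by force
    fix S T assume S: "S \<subseteq> V - U" and T: "T \<subseteq> V - U" and ST: "S \<inter> T = {}"
    let ?R = "V - U - S"
    define d where "d x = card {y \<in> ?R. {x, y} \<in> ?E}" for x
    define e where "e x = card {y \<in> ?R. {x, y} \<in> E}" for x
    define s where "s = real (card S)"
    have fin: "finite S" "finite T" using S T V by (auto intro: finite_subset)
    have nbr_fin: "finite {y. {x, y} \<in> E'}" if "simple_graph V E'" for x :: 'a and E'
      by (rule finite_subset[of _ V]) (use that in \<open>auto simp: simple_graph_def\<close>)
    have deh: "e x \<le> d x + degree H x" if "x \<in> T" for x
    proof -
      have "{y \<in> ?R. {x, y} \<in> E} \<subseteq> {y \<in> ?R. {x, y} \<in> ?E} \<union> {y. {x, y} \<in> H}"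
        using that T by auto
      then have "e x \<le> card ({y \<in> ?R. {x, y} \<in> ?E} \<union> {y. {x, y} \<in> H})"
        unfolding e_def using V nbr_fin[OF GH] by (intro card_mono) auto
      also have "\<dots> \<le> d x + degree H x"
        unfolding d_def degree_eq_card_neighbours[OF GH] by (rule card_Un_le)
      finally show ?thesis .
    qed
    have degS: "real (degree E x) \<le> real n' + s + real (e x)" if "x \<in> T" for x
    proof -
      have "{y. {x, y} \<in> E} \<subseteq> U \<union> S \<union> {y \<in> ?R. {x, y} \<in> E}"
        using G by (auto simp: simple_graph_def)
      then have "degree E x \<le> card (U \<union> S \<union> {y \<in> ?R. {x, y} \<in> E})"
        unfolding degree_eq_card_neighbours[OF G] using U fin V by (intro card_mono) auto
      also have "\<dots> \<le> card (U \<union> S) + e x" unfolding e_def by (rule card_Un_le)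
      also have "\<dots> \<le> n' + card S + e x" using card_Un_le[of U S] U by simp
      finally show ?thesis by (simp add: s_def)
    qed
    have mindeg: "real b * q / p + real m \<le> s + real (e x)" if "x \<in> T" for x
    proof -
      have "min_degree V E \<le> degree E x"
        unfolding min_degree_def using V T that by (intro Min_le) auto
      then show ?thesis using degS[OF that] assms(5) by (simp add: p_def q_def)
    qed
    have ore: "2 * N * q / (p + q) \<le> 2 * s + real (e x) + real (e y)"
      if "x \<in> T" "y \<in> T" "x \<noteq> y" "{x, y} \<notin> E" for x y
    proof -
      have "sigma2 V E \<le> ereal (real (degree E x + degree E y))"
        unfolding sigma2_def using that T by (intro Inf_lower) blast
      then have "2 * (real n * q + real n' * p) / (p + q) \<le> real (degree E x + degree E y)"
        using assms(8) by (force simp: p_def q_def add.commute dest: order_trans)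
      \<comment> \<open>Since \<open>n * q + n' * p = N * q + n' * (p + q)\<close>, the excess
        \<open>2 * n'\<close> pays for the neighbours of \<open>x\<close> and \<open>y\<close> lost
        in \<open>U\<close>.\<close>
      moreover have "2 * (real n * q + real n' * p) / (p + q) = 2 * N * q / (p + q) + 2 * real n'"
        using pq by (simp add: N_def field_simps)
      ultimately show ?thesis using degS[OF that(1)] degS[OF that(2)] by simp
    qed
    have Nbound: "(p + q + 2 * real m - 2) * (p + q) / p < N"
    proof -
      have ab: "real b + real a = p + q" "real a + real b = p + q" by (simp_all add: p_def q_def)
      show ?thesis using assms(6) unfolding ab p_def[symmetric] by (simp add: N_def)
    qed
    have Ncard: "real (card T) + s \<le> N"
    proof -
      have "card T + card S = card (T \<union> S)" using fin ST by (simp add: card_Un_disjoint Int_commute)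
      also have "\<dots> \<le> card (V - U)" using S T V by (intro card_mono) auto
      also have "\<dots> = n - n'" using U assms(2) by (simp add: card_Diff_subset)
      finally have "card T + card S \<le> n - n'" .
      \<comment> \<open>Needed because \<open>n - n'\<close> above is a truncated subtraction, while
        \<open>N\<close> is a real difference.\<close>
      moreover have "n' \<le> n" using U V assms(2) card_mono by blast
      ultimately show ?thesis by (simp add: N_def s_def)
    qed
    have hsum: "(\<Sum>x\<in>T. real (degree H x)) \<le> 2 * real m"
    proof -
      have "H \<subseteq> E" using H by blast
      then have "(\<Sum>x\<in>T. degree H x) \<le> 2 * m" using sum_degree_le[OF G _ fin(2)] H by blast
      then have "real (\<Sum>x\<in>T. degree H x) \<le> real (2 * m)" by (simp only: of_nat_le_iff)
      then show ?thesis by simp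
    qed
    have nbrs: "card {y \<in> T. {x, y} \<in> E} \<le> e x" for x
      unfolding e_def using T ST V by (intro card_mono) auto
    show "(\<Sum>x\<in>T. g x) \<le> (\<Sum>x\<in>S. f x) + (\<Sum>x\<in>T. int (card {y \<in> ?R. {x, y} \<in> ?E}))"
    proof (rule ccontr)
      assume "\<not> ?thesis"
      \<comment> \<open>Integer sums violate the inequality by at least 1; this unit supplies the
        strictness in the real estimates.\<close>
      then have "(\<Sum>x\<in>S. f x) + (\<Sum>x\<in>T. int (d x)) + 1 \<le> (\<Sum>x\<in>T. g x)" by (simp add: d_def)
      moreover have "(\<Sum>x\<in>T. g x) \<le> (\<Sum>x\<in>T. int b - int \<Delta>)"
        using assms(7) T by (intro sum_mono) force
      moreover have "(\<Sum>x\<in>S. int \<Delta> + int a) \<le> (\<Sum>x\<in>S. f x)"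
        using assms(7) S by (intro sum_mono) force
      ultimately have "(\<Sum>x\<in>S. int \<Delta> + int a) + (\<Sum>x\<in>T. int (d x)) + 1 \<le> (\<Sum>x\<in>T. int b - int \<Delta>)"
        by linarith
      then have "real_of_int ((\<Sum>x\<in>S. int \<Delta> + int a) + (\<Sum>x\<in>T. int (d x)) + 1)
          \<le> real_of_int (\<Sum>x\<in>T. int b - int \<Delta>)" by (simp only: of_int_le_iff)
      then have viol: "p * s + (\<Sum>x\<in>T. real (d x)) + 1 \<le> q * real (card T)"
        by (simp add: p_def q_def s_def mult.commute)
      show False
      proof (cases "real (card T) \<le> real b")
        case True
        \<comment> \<open>The spare \<open>m\<close> in \<open>mindeg\<close> pays for the at most
          \<open>m\<close> deleted edges at \<open>x\<close>.\<close>
        have "real b * q / p \<le> s + real (d x)" if "x \<in> T" for x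
          using mindeg[OF that] deh[OF that] degree_le_card[of H x] H by linarith
        then show False
          using small_T_impossible[OF fin(2) True _ pq(2) _ viol] pq(1) by (simp add: s_def)
      next
        case False
        then have "real b < real (card T)" by simp
        from large_T_impossible[OF fin(2) this pq _ _ viol deh hsum mindeg nbrs Ncard Nbound ore]
        show False by (simp add: s_def)
      qed
    qed
  qed
qed

end
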